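(* Let $\Gamma$ be a connected threshold graph with binary string $0^{s_1}1^{t_1}\cdots 0^{s_k}1^{t_k}$. If $\sigma(\mathcal{A})$ and $\sigma(\mathcal{B}_\pi)$ denote the spectra (sets of eigenvalues) of $\mathcal{A}$ and $\mathcal{B}_\pi$ respectively, then $$\sigma(\mathcal{A})=\sigma(\mathcal{B}_\pi)\cup T .$$
   Context: Binary strings: a threshold graph with binary string $b=b_1\ldots b_n$ (where $b_1=0$) is the simple graph on vertices $1,\dots,n$ built by adding vertices in order, vertex $i\ge 2$ being added as an isolated vertex if $b_i=0$ and as a dominating vertex (adjacent to all earlier vertices) if $b_i=1$. A connected threshold graph on $n\ge 2$ vertices has $b_n=1$, and its string is written $0^{s_1}1^{t_1}\cdots0^{s_k}1^{t_k}$ with $k\ge1$ and all $s_i,t_i$ positive integers. Put $s=\sum_i s_i$, $t=\sum_i t_i$, $S_i=\sum_{j\le i}s_j$. The normalized adjacency matrix of $\Gamma$ is $\mathcal{A}=D^{-1}A$, where $A$ is the adjacency matrix and $D$ the diagonal matrix of vertex degrees. The partition $\pi=\{C_1,\dots,C_{2k}\}$ of the vertices is: $C_1$ is the first $s_1$ vertices, $C_2$ the next $t_1$ vertices, $C_3$ the next $s_2$ vertices, and so on (so $|C_{2j-1}|=s_j$, $|C_{2j}|=t_j$). It is equitable. $B_\pi=(b_{ij})$ is the $2k\times 2k$ matrix with $b_{ij}$ the number of neighbours in $C_j$ of any vertex of $C_i$; $D_\pi$ is the diagonal matrix whose $i$-th entry is $d(C_i)=\sum_j b_{ij}$, the common degree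 of the vertices in $C_i$; and $\mathcal{B}_\pi=D_\pi^{-1}B_\pi$. The set $T$ is $$T=\begin{cases}\{0\}\cup\left\{\frac{-1}{t+S_i-1}: t_i>1\right\}, & s>k,\\[2pt] \left\{\frac{-1}{t+S_i-1}: t_i>1\right\}, & s=k.\end{cases}$$ *)

theory Defs
  imports
    "Graph_Theory.Graph_Theory"
    "Jordan_Normal_Form.Gauss_Jordan_Elimination"
    "Jordan_Normal_Form.Spectral_Radius"
begin

text \<open>
  A simple graph is a symmetric loop-free digraph whose arcs are pairs of vertices
  (locale \<open>pair_graph\<close>), so the edge between \<open>u\<close> and \<open>v\<close> is the pair of arcs
  \<open>(u, v)\<close>, \<open>(v, u)\<close>, and the degree of a vertex is its \<open>out_degree\<close>.
  Vertices are numbered from 1. Binary strings are Boolean lists, with \<open>False\<close> for the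
  letter 0 and \<open>True\<close> for the letter 1; since lists are indexed from 0, the letter
  belonging to vertex \<open>i\<close> is \<open>b ! (i - 1)\<close>.
\<close>

definition add_isolated :: "'a \<Rightarrow> 'a pair_pre_digraph \<Rightarrow> 'a pair_pre_digraph" where
  "add_isolated v G = \<lparr> pverts = insert v (pverts G), parcs = parcs G \<rparr>"

definition add_dominating :: "'a \<Rightarrow> 'a pair_pre_digraph \<Rightarrow> 'a pair_pre_digraph" where
  "add_dominating v G =
     \<lparr> pverts = insert v (pverts G),
       parcs = parcs G \<union> {v} \<times> pverts G \<union> pverts G \<times> {v} \<rparr>"

text \<open>
  On the empty graph both operations agree, so the first letter of the string has no
  influence on the graph; by convention it is 0.
\<close>

primrec threshold_stage :: "bool list \<Rightarrow> nat \<Rightarrow> nat pair_pre_digraph" where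
  "threshold_stage b 0 = \<lparr> pverts = {}, parcs = {} \<rparr>"
| "threshold_stage b (Suc m) =
     (if b ! m then add_dominating (Suc m) (threshold_stage b m)
      else add_isolated (Suc m) (threshold_stage b m))"

definition threshold_graph :: "bool list \<Rightarrow> nat pair_pre_digraph" where
  "threshold_graph b = threshold_stage b (length b)"

text \<open>
  The string \<open>0^(s 1) 1^(t 1) ... 0^(s k) 1^(t k)\<close>. Only the values of \<open>s\<close> and \<open>t\<close>
  on \<open>{1..k}\<close> matter.
\<close>

definition block_string :: "nat \<Rightarrow> (nat \<Rightarrow> nat) \<Rightarrow> (nat \<Rightarrow> nat) \<Rightarrow> bool list" where
  "block_string k s t =
     concat (map (\<lambda>i. replicate (s i) False @ replicate (t i) True) [1..<Suc k])"

text \<open>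
  Matrices are indexed from 0, so row and column \<open>i\<close> belong to vertex \<open>Suc i\<close>; the
  definitions are meant for graphs with vertex set \<open>{1..n}\<close>. The entries are complex,
  so that spectra comprise all eigenvalues and not only the real ones.
\<close>

definition adjacency_matrix :: "nat pair_pre_digraph \<Rightarrow> complex mat" where
  "adjacency_matrix G =
     Matrix.mat (card (pverts G)) (card (pverts G))
       (\<lambda>(i, j). of_bool (Suc i \<rightarrow>\<^bsub>with_proj G\<^esub> Suc j))"

definition degree_matrix :: "nat pair_pre_digraph \<Rightarrow> complex mat" where
  "degree_matrix G = mat_diag (card (pverts G)) (\<lambda>i. of_nat (out_degree (with_proj G) (Suc i)))"

definition normalized_adjacency_matrix :: "nat pair_pre_digraph \<Rightarrow> complex mat" where
  "normalized_adjacency_matrix G = the (mat_inverse (degree_matrix G)) * adjacency_matrix G"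

text \<open>
  A partition into \<open>m\<close> cells is a family \<open>C 1, ..., C m\<close> of vertex sets. The definite
  descriptor below is meaningful exactly for equitable partitions with nonempty cells.
\<close>

definition cell_degree :: "nat pair_pre_digraph \<Rightarrow> (nat \<Rightarrow> nat set) \<Rightarrow> nat \<Rightarrow> nat \<Rightarrow> nat" where
  "cell_degree G C i j = (THE d. \<forall>v\<in>C i. card {w \<in> C j. v \<rightarrow>\<^bsub>with_proj G\<^esub> w} = d)"

definition quotient_matrix :: "nat pair_pre_digraph \<Rightarrow> (nat \<Rightarrow> nat set) \<Rightarrow> nat \<Rightarrow> complex mat" where
  "quotient_matrix G C m =
     Matrix.mat m m (\<lambda>(i, j). of_nat (cell_degree G C (Suc i) (Suc j)))"

definition quotient_degree_matrix ::
    "nat pair_pre_digraph \<Rightarrow> (nat \<Rightarrow> nat set) \<Rightarrow> nat \<Rightarrow> complex mat" where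
  "quotient_degree_matrix G C m =
     mat_diag m (\<lambda>i. of_nat (\<Sum>j = 1..m. cell_degree G C (Suc i) j))"

definition normalized_quotient_matrix ::
    "nat pair_pre_digraph \<Rightarrow> (nat \<Rightarrow> nat set) \<Rightarrow> nat \<Rightarrow> complex mat" where
  "normalized_quotient_matrix G C m =
     the (mat_inverse (quotient_degree_matrix G C m)) * quotient_matrix G C m"

text \<open>The cells \<open>C 1, ..., C (2 * k)\<close> have sizes \<open>s 1, t 1, s 2, t 2, ..., s k, t k\<close>.\<close>

definition cell_size :: "(nat \<Rightarrow> nat) \<Rightarrow> (nat \<Rightarrow> nat) \<Rightarrow> nat \<Rightarrow> nat" where
  "cell_size s t l = (if odd l then s ((l + 1) div 2) else t (l div 2))"

definition cell :: "(nat \<Rightarrow> nat) \<Rightarrow> (nat \<Rightarrow> nat) \<Rightarrow> nat \<Rightarrow> nat set" where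
  "cell s t l = {(\<Sum>i = 1..<l. cell_size s t i) <.. (\<Sum>i = 1..l. cell_size s t i)}"

definition T_set :: "nat \<Rightarrow> (nat \<Rightarrow> nat) \<Rightarrow> (nat \<Rightarrow> nat) \<Rightarrow> complex set" where
  "T_set k s t =
     (let ssum = (\<Sum>i = 1..k. s i);
          tsum = (\<Sum>i = 1..k. t i);
          R = {- 1 / (of_nat tsum + of_nat (\<Sum>j = 1..i. s j) - 1) | i. i \<in> {1..k} \<and> t i > 1}
      in if ssum > k then {0} \<union> R else R)"


subsection \<open>The graph is simple and connected\<close>

lemma threshold_stage_verts: "pverts (threshold_stage b m) = {1..m}"
  by (induction m) (auto simp: add_isolated_def add_dominating_def)

lemma threshold_stage_adj:
  "(i, j) \<in> parcs (threshold_stage b m) \<longleftrightarrow>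
     i \<in> {1..m} \<and> j \<in> {1..m} \<and> i \<noteq> j \<and> b ! (max i j - 1)"
proof (induction m)
  case 0
  then show ?case by simp
next
  case (Suc m)
  have *: "(i, j) \<in> parcs (threshold_stage b (Suc m)) \<longleftrightarrow>
      (i, j) \<in> parcs (threshold_stage b m) \<or>
      b ! m \<and> (i = Suc m \<and> j \<in> {1..m} \<or> j = Suc m \<and> i \<in> {1..m})"
    by (simp add: add_isolated_def add_dominating_def threshold_stage_verts) blast
  consider "i \<noteq> Suc m" "j \<noteq> Suc m" | "i = Suc m" "j = Suc m"
    | "i = Suc m" "j \<noteq> Suc m" | "i \<noteq> Suc m" "j = Suc m" by blast
  then show ?case
  proof cases
    case 1
    then show ?thesis unfolding * Suc.IH by (simp add: le_Suc_eq)
  next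
    case 2
    then show ?thesis unfolding * Suc.IH by simp
  next
    case 3
    then have "j \<in> {1..Suc m} \<longleftrightarrow> j \<in> {1..m}" by auto
    moreover have "max (Suc m) j - 1 = m" if "j \<in> {1..m}" using that by simp
    ultimately show ?thesis using 3 unfolding * Suc.IH by auto
  next
    case 4
    then have "i \<in> {1..Suc m} \<longleftrightarrow> i \<in> {1..m}" by auto
    moreover have "max i (Suc m) - 1 = m" if "i \<in> {1..m}" using that by simp
    ultimately show ?thesis using 4 unfolding * Suc.IH by auto
  qed
qed

lemma threshold_graph_verts: "pverts (threshold_graph b) = {1..length b}"
  by (simp add: threshold_graph_def threshold_stage_verts)

lemma threshold_graph_arcs:
  "parcs (threshold_graph b) =
     {(i, j). i \<in> {1..length b} \<and> j \<in> {1..length b} \<and> i \<noteq> j \<and> b ! (max i j - 1)}"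
  by (auto simp: threshold_graph_def threshold_stage_adj)

lemma pair_graph_threshold_graph: "pair_graph (threshold_graph b)"
proof
  show "finite (parcs (threshold_graph b))"
    by (rule finite_subset[of _ "{1..length b} \<times> {1..length b}"])
       (auto simp: threshold_graph_arcs)
  show "symmetric (with_proj (threshold_graph b))"
    by (auto simp: symmetric_def sym_def threshold_graph_arcs max.commute)
qed (auto simp: threshold_graph_verts threshold_graph_arcs)

lemma connected_threshold_graph:
  assumes "b \<noteq> []" and "last b"
  shows "connected (with_proj (threshold_graph b))"
proof -
  let ?G = "threshold_graph b"
  let ?n = "length b"
  interpret pair_graph ?G by (rule pair_graph_threshold_graph)
  have n: "?n \<in> pverts ?G" using assms(1) by (cases b) (auto simp: threshold_graph_verts)
  have *: "u \<rightarrow>\<^sup>*\<^bsub>with_proj ?G\<^esub> ?n" if "u \<in> pverts ?G" for u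
  proof (cases "u = ?n")
    case True
    then show ?thesis using n by (simp add: reachable_refl)
  next
    case False
    then have "(u, ?n) \<in> parcs ?G"
      using that assms n
      by (auto simp: threshold_graph_arcs threshold_graph_verts last_conv_nth max_def)
    then show ?thesis by (intro reachable_adjI) simp
  qed
  have "strongly_connected (with_proj ?G)"
  proof (rule strongly_connectedI)
    show "verts (with_proj ?G) \<noteq> {}" using n by auto
    show "u \<rightarrow>\<^sup>*\<^bsub>with_proj ?G\<^esub> v" if "u \<in> verts (with_proj ?G)" "v \<in> verts (with_proj ?G)" for u v
    proof -
      have u: "u \<rightarrow>\<^sup>*\<^bsub>with_proj ?G\<^esub> ?n" and v: "v \<rightarrow>\<^sup>*\<^bsub>with_proj ?G\<^esub> ?n"
        using * that by simp_all
      from v have "?n \<rightarrow>\<^sup>*\<^bsub>with_proj ?G\<^esub> v"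
        by (rule symmetric_reachable[OF sym_arcs])
      with u show ?thesis by (rule reachable_trans)
    qed
  qed
  then show ?thesis
    by (simp add: connected_def strongly_connected_def reachable_mk_symmetric_eq[OF sym_arcs])
qed

lemma last_block_string:
  assumes "k \<ge> 1" and "t k > 0"
  shows "block_string k s t \<noteq> [] \<and> last (block_string k s t)"
proof -
  obtain m where "k = Suc m" using assms(1) by (cases k) auto
  then show ?thesis using assms(2) by (simp add: block_string_def)
qed

lemma connected_block_string:
  assumes "k \<ge> 1" and "t k > 0"
  shows "connected (with_proj (threshold_graph (block_string k s t)))"
  using connected_threshold_graph last_block_string[where k = k and t = t, OF assms] by blast


subsection \<open>The partition into cells is equitable\<close>

lemma length_block_string: "length (block_string k s t) = (\<Sum>i = 1..2 * k. cell_size s t i)"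
  by (induction k) (simp_all add: block_string_def cell_size_def)

lemma cell_subset: "l \<le> m \<Longrightarrow> cell s t l \<subseteq> {1..\<Sum>i = 1..m. cell_size s t i}"
proof
  fix v assume "l \<le> m" "v \<in> cell s t l"
  moreover from this have "(\<Sum>i = 1..l. cell_size s t i) \<le> (\<Sum>i = 1..m. cell_size s t i)"
    by (intro sum_mono2) auto
  ultimately show "v \<in> {1..\<Sum>i = 1..m. cell_size s t i}" by (auto simp: cell_def)
qed

lemma cell_less:
  assumes "i < j" "v \<in> cell s t i" "w \<in> cell s t j"
  shows "v < w"
proof -
  have "v \<le> (\<Sum>l = 1..i. cell_size s t l)" using assms(2) by (simp add: cell_def)
  also have "\<dots> \<le> (\<Sum>l = 1..<j. cell_size s t l)" using assms(1) by (intro sum_mono2) auto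
  also have "\<dots> < w" using assms(3) by (simp add: cell_def)
  finally show ?thesis .
qed

lemma card_cell: "l \<ge> 1 \<Longrightarrow> card (cell s t l) = cell_size s t l"
  by (cases l) (simp_all add: cell_def atLeastLessThanSuc_atLeastAtMost)

lemma UN_cell: "(\<Union>l\<in>{1..m}. cell s t l) = {1..\<Sum>i = 1..m. cell_size s t i}"
proof (induction m)
  case 0
  then show ?case by simp
next
  case (Suc m)
  have "{1..Suc m} = insert (Suc m) {1..m}" by auto
  then have "(\<Union>l\<in>{1..Suc m}. cell s t l) =
      cell s t (Suc m) \<union> {1..\<Sum>i = 1..m. cell_size s t i}"
    using Suc.IH by simp
  also have "\<dots> = {1..\<Sum>i = 1..Suc m. cell_size s t i}"
    by (auto simp: cell_def atLeastLessThanSuc_atLeastAtMost)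
  finally show ?case .
qed

lemma block_string_nth:
  assumes "l \<in> {1..2 * k}" "v \<in> cell s t l"
  shows "block_string k s t ! (v - 1) \<longleftrightarrow> even l"
  using assms
proof (induction k)
  case 0
  then show ?case by simp
next
  case (Suc k)
  let ?N = "\<Sum>i = 1..2 * k. cell_size s t i"
  have eq: "block_string (Suc k) s t =
      block_string k s t @ replicate (s (Suc k)) False @ replicate (t (Suc k)) True"
    by (simp add: block_string_def)
  have len: "length (block_string k s t) = ?N" by (rule length_block_string)
  consider "l \<le> 2 * k" | "l = Suc (2 * k)" | "l = Suc (Suc (2 * k))" using Suc.prems by fastforce
  then show ?case
  proof cases
    case 1
    then have "v \<in> {1..?N}" using cell_subset Suc.prems(2) by blast
    then have "block_string (Suc k) s t ! (v - 1) = block_string k s t ! (v - 1)"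
      unfolding eq by (simp add: nth_append len less_eq_Suc_le)
    then show ?thesis using Suc 1 by simp
  next
    case 2
    then have "v \<in> {?N<..?N + s (Suc k)}"
      using Suc.prems(2) by (simp add: cell_def cell_size_def atLeastLessThanSuc_atLeastAtMost)
    then show ?thesis unfolding eq using 2 by (auto simp: nth_append len)
  next
    case 3
    then have "v \<in> {?N + s (Suc k)<..?N + s (Suc k) + t (Suc k)}"
      using Suc.prems(2) by (simp add: cell_def cell_size_def atLeastLessThanSuc_atLeastAtMost)
    then show ?thesis unfolding eq using 3 by (auto simp: nth_append len)
  qed
qed

lemma card_neighbours_cell:
  assumes "i \<in> {1..2 * k}" "j \<in> {1..2 * k}" "v \<in> cell s t i"
  shows "card {w \<in> cell s t j. v \<rightarrow>\<^bsub>with_proj (threshold_graph (block_string k s t))\<^esub> w} =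
    (if even (max i j) then if i = j then cell_size s t j - 1 else cell_size s t j else 0)"
proof -
  let ?b = "block_string k s t"
  have adj: "v \<rightarrow>\<^bsub>with_proj (threshold_graph ?b)\<^esub> w \<longleftrightarrow> v \<noteq> w \<and> even (max i j)"
    if w: "w \<in> cell s t j" for w
  proof -
    have "v \<in> {1..length ?b}" "w \<in> {1..length ?b}"
      using assms w cell_subset[of i "2 * k" s t] cell_subset[of j "2 * k" s t]
      unfolding length_block_string by auto
    then have "v \<rightarrow>\<^bsub>with_proj (threshold_graph ?b)\<^esub> w \<longleftrightarrow> v \<noteq> w \<and> ?b ! (max v w - 1)"
      by (auto simp: threshold_graph_arcs)
    moreover have "max v w \<in> cell s t (max i j)"
      using assms w cell_less[of i j v s t w] cell_less[of j i w s t v]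
      by (cases i j rule: linorder_cases) (auto simp: max_def)
    then have "?b ! (max v w - 1) \<longleftrightarrow> even (max i j)"
      using assms by (intro block_string_nth) (auto simp: max_def)
    ultimately show ?thesis by simp
  qed
  have eq: "{w \<in> cell s t j. v \<rightarrow>\<^bsub>with_proj (threshold_graph ?b)\<^esub> w} =
      (if even (max i j) then cell s t j - {v} else {})"
    using adj by auto
  have "v \<notin> cell s t j" if "i \<noteq> j"
    using that assms cell_less[of i j v s t v] cell_less[of j i v s t v] by (cases i j rule: linorder_cases) auto
  then show ?thesis
    unfolding eq using assms card_cell[of j s t] by auto
qed

lemma cell_degree_eq:
  assumes "i \<in> {1..2 * k}" "j \<in> {1..2 * k}" "v \<in> cell s t i"
  shows "cell_degree (threshold_graph (block_string k s t)) (cell s t) i j =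
    card {w \<in> cell s t j. v \<rightarrow>\<^bsub>with_proj (threshold_graph (block_string k s t))\<^esub> w}"
  unfolding cell_degree_def
proof (rule the_equality)
  show "\<forall>u\<in>cell s t i.
      card {w \<in> cell s t j. u \<rightarrow>\<^bsub>with_proj (threshold_graph (block_string k s t))\<^esub> w} =
      card {w \<in> cell s t j. v \<rightarrow>\<^bsub>with_proj (threshold_graph (block_string k s t))\<^esub> w}"
    using assms card_neighbours_cell by simp
qed (use assms(3) in \<open>auto dest: bspec[OF _ assms(3)]\<close>)

end

theory Submission
  imports Defs
begin

text \<open>
  The eigenvalue equation \<open>D\<inverse> A x = \<lambda> x\<close> says \<open>A x = \<lambda> D x\<close>, that is,
  \<open>\<Sum>w\<sim>v. x w = \<lambda> d(v) x(v)\<close> at every vertex \<open>v\<close>. Vertices in one cell of \<open>\<pi>\<close> are twins: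
  whether \<open>v \<noteq> w\<close> are adjacent depends only on their cells, so the left-hand side equals
  a quantity depending on \<open>x\<close> only through its sums over the cells, the same at all vertices of
  the cell of \<open>v\<close>, minus \<open>x v\<close> if the cell of
  \<open>v\<close> is a clique (lemma \<open>adj_row_sum\<close>).

  Averaging an eigenvector over the cells therefore gives a solution of the quotient equation with
  the same \<open>\<lambda>\<close>. If the averages are not all zero, \<open>\<lambda>\<close> is an eigenvalue of the quotient. If they
  all vanish, only the term \<open>- x v\<close> or \<open>0\<close> is left of the equation at \<open>v\<close>; at a vertex
  with \<open>x v \<noteq> 0\<close> it forces \<open>\<lambda> = -1 / d(v)\<close> if the cell of \<open>v\<close> is a clique and \<open>\<lambda> = 0\<close> if it is
  independent, and the cell has a second vertex because its entries sum to zero. Conversely, a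
  quotient eigenvector lifts to a vector constant on cells, and the difference of the unit vectors
  at two vertices of one cell is an eigenvector for the value above (theorem \<open>pencil_spectrum_twins\<close>).

  In the threshold graph the even cells are cliques and the odd cells are independent. A vertex
  of the cell \<open>2 m\<close> has degree \<open>t + S\<^sub>m - 1\<close>: it sees the other
  \<open>t - 1\<close> dominating vertices and the \<open>S\<^sub>m\<close> isolated vertices added before it. Since all \<open>s\<^sub>i\<close>
  are positive, some independent cell has two vertices exactly if \<open>s > k\<close>. This turns the extra eigenvalues into the set \<open>T\<close>.
\<close>

section \<open>Spectra of diagonally scaled matrices\<close>

text \<open>
  The eigenvalues of the matrix pencil \<open>M - \<lambda> diag d\<close> with respect to an arbitrary index set. In
  this form vertices and cells can serve directly as indices, and no inverse occurs.
\<close>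

definition pencil_spectrum :: "'i set \<Rightarrow> ('i \<Rightarrow> 'i \<Rightarrow> 'f) \<Rightarrow> ('i \<Rightarrow> 'f) \<Rightarrow> 'f::field set" where
  "pencil_spectrum I M d =
     {c. \<exists>x. (\<exists>i\<in>I. x i \<noteq> 0) \<and> (\<forall>i\<in>I. (\<Sum>j\<in>I. M i j * x j) = c * (d i * x i))}"

lemma pencil_spectrum_cong:
  assumes "\<And>i j. i \<in> I \<Longrightarrow> j \<in> I \<Longrightarrow> M i j = M' i j" and "\<And>i. i \<in> I \<Longrightarrow> d i = d' i"
  shows "pencil_spectrum I M d = pencil_spectrum I M' d'"
  using assms by (simp add: pencil_spectrum_def)

lemma mat_inverse_mat_diag:
  fixes d :: "nat \<Rightarrow> 'f::field"
  assumes "\<And>i. i < n \<Longrightarrow> d i \<noteq> 0"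
  shows "mat_inverse (mat_diag n d) = Some (mat_diag n (\<lambda>i. inverse (d i)))"
proof -
  let ?D = "mat_diag n d" and ?E = "mat_diag n (\<lambda>i. inverse (d i))"
  have DE: "?D * ?E = 1\<^sub>m n" and ED: "?E * ?D = 1\<^sub>m n"
    unfolding mat_diag_diag
    by (rule eq_matI; use assms in \<open>simp add: mat_diag_def one_mat_def\<close>)+
  show ?thesis
  proof (cases "mat_inverse ?D")
    case None
    have "?D \<in> Units (ring_mat TYPE('f) n b)" for b :: unit
      using DE ED by (auto simp: Units_def ring_mat_def intro!: bexI[of _ ?E])
    with mat_inverse(1)[OF mat_diag_dim None, of "()"] show ?thesis by blast
  next
    case (Some B)
    from mat_inverse(2)[OF mat_diag_dim Some]
    have B: "B * ?D = 1\<^sub>m n" "B \<in> carrier_mat n n" by auto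
    have "B = B * (?D * ?E)" using B DE by simp
    also have "\<dots> = ?E" using B left_mult_one_mat[OF mat_diag_dim]
      by (subst assoc_mult_mat[symmetric, of _ n n _ n _ n]) simp_all
    finally show ?thesis using Some by simp
  qed
qed

lemma spectrum_inverse_diag_times:
  fixes d :: "nat \<Rightarrow> 'f::field"
  assumes d: "\<And>i. i \<in> {1..n} \<Longrightarrow> d i \<noteq> 0"
  shows "spectrum (the (mat_inverse (mat_diag n (\<lambda>i. d (Suc i)))) *
           Matrix.mat n n (\<lambda>(i, j). M (Suc i) (Suc j))) = pencil_spectrum {1..n} M d"
proof -
  define N where "N = the (mat_inverse (mat_diag n (\<lambda>i. d (Suc i)))) *
      Matrix.mat n n (\<lambda>(i, j). M (Suc i) (Suc j))"
  have N: "N = Matrix.mat n n (\<lambda>(i, j). inverse (d (Suc i)) * M (Suc i) (Suc j))"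
    unfolding N_def using d
    by (subst mat_inverse_mat_diag) (auto simp: mat_diag_mult_left[of _ n n])
  have dim: "dim_row N = n" by (simp add: N)
  have sets: "{1..n} = Suc ` {..<n}"
    by (simp add: lessThan_atLeast0 atLeastLessThanSuc_atLeastAtMost)
  have eig: "eigenvector N (Matrix.vec n (\<lambda>i. x (Suc i))) c \<longleftrightarrow>
      (\<exists>i\<in>{1..n}. x i \<noteq> 0) \<and> (\<forall>i\<in>{1..n}. (\<Sum>j\<in>{1..n}. M i j * x j) = c * (d i * x i))"
    for x c
  proof -
    let ?v = "Matrix.vec n (\<lambda>i. x (Suc i))"
    have row: "(N *\<^sub>v ?v) $ i = inverse (d (Suc i)) * (\<Sum>j<n. M (Suc i) (Suc j) * x (Suc j))"
      if "i < n" for i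
      using that unfolding N
      by (simp add: scalar_prod_def sum_distrib_left mult.assoc lessThan_atLeast0)
    have "N *\<^sub>v ?v = c \<cdot>\<^sub>v ?v \<longleftrightarrow> (\<forall>i<n. (N *\<^sub>v ?v) $ i = c * x (Suc i))"
      by (simp add: vec_eq_iff dim)
    also have "\<dots> \<longleftrightarrow> (\<forall>i<n. (\<Sum>j<n. M (Suc i) (Suc j) * x (Suc j)) = c * (d (Suc i) * x (Suc i)))"
    proof -
      have "inverse (d (Suc i)) * a = c * b \<longleftrightarrow> a = c * (d (Suc i) * b)" if "i < n" for a b i
        using d[of "Suc i"] that by (auto simp: field_simps)
      then show ?thesis by (simp add: row)
    qed
    also have "\<dots> \<longleftrightarrow> (\<forall>i\<in>{1..n}. (\<Sum>j\<in>{1..n}. M i j * x j) = c * (d i * x i))"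
      by (simp only: sets sum.reindex[OF inj_Suc[THEN inj_on_subset[OF _ subset_UNIV]]] ball_simps o_def lessThan_iff Ball_def[of "{..<n}"])
    finally have "N *\<^sub>v ?v = c \<cdot>\<^sub>v ?v \<longleftrightarrow>
      (\<forall>i\<in>{1..n}. (\<Sum>j\<in>{1..n}. M i j * x j) = c * (d i * x i))" .
    moreover have "?v \<noteq> 0\<^sub>v n \<longleftrightarrow> (\<exists>i\<in>{1..n}. x i \<noteq> 0)"
      unfolding sets by (auto simp: vec_eq_iff)
    ultimately show ?thesis by (simp only: eigenvector_def dim) simp
  qed
  \<comment> \<open>Vectors are indexed from \<open>0\<close>, the pencil from \<open>1\<close>.\<close>
  have "eigenvalue N c \<longleftrightarrow> (\<exists>x. eigenvector N (Matrix.vec n (\<lambda>i. x (Suc i))) c)" for c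
  proof
    assume "eigenvalue N c"
    then obtain v where v: "eigenvector N v c" by (auto simp: eigenvalue_def)
    then have "Matrix.vec n (\<lambda>i. v $ (Suc i - 1)) = v"
      by (auto simp: eigenvector_def dim vec_eq_iff)
    with v have "eigenvector N (Matrix.vec n (\<lambda>i. v $ (Suc i - 1))) c" by (simp only:)
    then show "\<exists>x. eigenvector N (Matrix.vec n (\<lambda>i. x (Suc i))) c"
      by (rule exI[of _ "\<lambda>i. v $ (i - 1)"])
  qed (auto simp: eigenvalue_def)
  then show ?thesis
    unfolding N_def[symmetric] by (simp add: spectrum_def pencil_spectrum_def eig set_eq_iff)
qed

section \<open>Partitions into classes of twins\<close>

text \<open>
  The relation \<open>q\<close> on cells determines adjacency of distinct vertices. Thus \<open>q i i\<close> says whether the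
  cell \<open>C i\<close> is a clique or an independent set, and the partition is equitable.
\<close>

locale twin_partition =
  fixes I :: "'i set" and C :: "'i \<Rightarrow> 'a set"
    and adj :: "'a \<Rightarrow> 'a \<Rightarrow> bool" and q :: "'i \<Rightarrow> 'i \<Rightarrow> bool"
  assumes finite_cells: "finite I"
    and finite_cell: "i \<in> I \<Longrightarrow> finite (C i)"
    and cell_nonempty: "i \<in> I \<Longrightarrow> C i \<noteq> {}"
    and disjoint_cells: "disjoint_family_on C I"
    and adj_iff: "\<lbrakk>i \<in> I; j \<in> I; v \<in> C i; w \<in> C j\<rbrakk> \<Longrightarrow> adj v w \<longleftrightarrow> v \<noteq> w \<and> q i j"
begin

definition neighbours :: "'i \<Rightarrow> 'i \<Rightarrow> nat" where
  "neighbours i j = (if q i j then if i = j then card (C j) - 1 else card (C j) else 0)"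

lemma card_cell_pos: "i \<in> I \<Longrightarrow> card (C i) > 0"
  using finite_cell cell_nonempty by (simp add: card_gt_0_iff)

lemma cell_unique: "\<lbrakk>i \<in> I; j \<in> I; v \<in> C i; v \<in> C j\<rbrakk> \<Longrightarrow> i = j"
  using disjoint_cells by (auto simp: disjoint_family_on_def)

lemma sum_cells:
  fixes f :: "'a \<Rightarrow> 'b::comm_monoid_add"
  shows "(\<Sum>v\<in>(\<Union>i\<in>I. C i). f v) = (\<Sum>i\<in>I. \<Sum>v\<in>C i. f v)"
  using finite_cells finite_cell disjoint_cells
  by (intro sum.UNION_disjoint) (auto simp: disjoint_family_on_def)

text \<open>
  A vertex sees the whole of every cell that \<open>q\<close> relates to its own, except that it does not see
  itself.
\<close>

lemma adj_row_sum:
  fixes x :: "'a \<Rightarrow> 'f::field_char_0"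
  assumes i: "i \<in> I" and v: "v \<in> C i"
  shows "(\<Sum>w\<in>(\<Union>j\<in>I. C j). of_bool (adj v w) * x w) =
    (\<Sum>j\<in>I. of_bool (q i j) * (\<Sum>w\<in>C j. x w)) - of_bool (q i i) * x v"
proof -
  have "(\<Sum>w\<in>C j. of_bool (adj v w) * x w) =
      of_bool (q i j) * (\<Sum>w\<in>C j. x w) - (if j = i then of_bool (q i i) * x v else 0)"
    if j: "j \<in> I" for j
  proof -
    have "(\<Sum>w\<in>C j. of_bool (adj v w) * x w) =
        (\<Sum>w\<in>C j. of_bool (q i j) * x w - (if w = v then of_bool (q i j) * x v else 0))"
      by (intro sum.cong) (auto simp: adj_iff[OF i j v])
    also have "\<dots> = of_bool (q i j) * (\<Sum>w\<in>C j. x w) - (if v \<in> C j then of_bool (q i j) * x v else 0)"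
      using finite_cell[OF j] by (simp add: sum_subtractf sum_distrib_left)
    also have "v \<in> C j \<longleftrightarrow> j = i" using cell_unique[OF i j v] v by blast
    finally show ?thesis by simp
  qed
  then show ?thesis
    using i finite_cells by (simp add: sum_cells sum_subtractf)
qed

lemma neighbours_row_sum:
  fixes y :: "'i \<Rightarrow> 'f::field_char_0"
  assumes i: "i \<in> I"
  shows "(\<Sum>j\<in>I. of_nat (neighbours i j) * y j) =
    (\<Sum>j\<in>I. of_bool (q i j) * (of_nat (card (C j)) * y j)) - of_bool (q i i) * y i"
proof -
  have "of_nat (neighbours i j) * y j =
      of_bool (q i j) * (of_nat (card (C j)) * y j) - (if j = i then of_bool (q i i) * y i else 0)"
    if "j \<in> I" for j
    using card_cell_pos[OF that] by (auto simp: neighbours_def of_nat_diff algebra_simps)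
  then show ?thesis using i finite_cells by (simp add: sum_subtractf)
qed

lemma card_adj:
  assumes i: "i \<in> I" and v: "v \<in> C i"
  shows "card {w \<in> (\<Union>j\<in>I. C j). adj v w} = (\<Sum>j\<in>I. neighbours i j)"
proof -
  have fin: "finite (\<Union>j\<in>I. C j)" using finite_cells finite_cell by blast
  \<comment> \<open>Both row sums are applied to the constant vector \<open>1\<close>.\<close>
  have "of_nat (card {w \<in> (\<Union>j\<in>I. C j). adj v w}) =
      (\<Sum>w\<in>(\<Union>j\<in>I. C j). of_bool (adj v w) * 1 :: rat)"
    using fin by (simp add: Int_def)
  also have "\<dots> = of_nat (\<Sum>j\<in>I. neighbours i j)"
    unfolding adj_row_sum[OF i v] using neighbours_row_sum[OF i, of "\<lambda>_. 1 :: rat"] by simp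
  finally show ?thesis by (simp only: of_nat_eq_iff)
qed

text \<open>A vector on the cells extends to the vertices as a function constant on each cell.\<close>

lemma quotient_eigenvalue_lifts:
  fixes d :: "'a \<Rightarrow> 'f::field_char_0" and e :: "'i \<Rightarrow> 'f"
  assumes d: "\<And>i v. i \<in> I \<Longrightarrow> v \<in> C i \<Longrightarrow> d v = e i"
    and c: "c \<in> pencil_spectrum I (\<lambda>i j. of_nat (neighbours i j)) e"
  shows "c \<in> pencil_spectrum (\<Union>i\<in>I. C i) (\<lambda>v w. of_bool (adj v w)) d"
proof -
  from c obtain y i\<^sub>0 where i0: "i\<^sub>0 \<in> I" "y i\<^sub>0 \<noteq> 0"
    and y: "\<And>i. i \<in> I \<Longrightarrow> (\<Sum>j\<in>I. of_nat (neighbours i j) * y j) = c * (e i * y i)"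
    by (auto simp: pencil_spectrum_def)
  define x where "x v = y (THE i. i \<in> I \<and> v \<in> C i)" for v
  have x: "x v = y i" if "i \<in> I" "v \<in> C i" for i v
    unfolding x_def using that cell_unique by (intro arg_cong[of _ _ y] the_equality) auto
  have "\<exists>v\<in>(\<Union>i\<in>I. C i). x v \<noteq> 0"
    using i0 x cell_nonempty[OF i0(1)] by fastforce
  moreover have "(\<Sum>w\<in>(\<Union>j\<in>I. C j). of_bool (adj v w) * x w) = c * (d v * x v)"
    if i: "i \<in> I" and v: "v \<in> C i" for i v
  proof -
    have "(\<Sum>w\<in>C j. x w) = of_nat (card (C j)) * y j" if "j \<in> I" for j
      using x[OF that] by simp
    then show ?thesis
      unfolding adj_row_sum[OF i v] using neighbours_row_sum[OF i, of y] y[OF i] d[OF i v] x[OF i v]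
      by simp
  qed
  ultimately show ?thesis by (auto simp: pencil_spectrum_def intro!: exI[of _ x])
qed

text \<open>
  The eigenvector is the difference of the unit vectors at two vertices of \<open>C i\<close>. It has sum zero on
  every cell, so a row sum only retains the vertex itself.
\<close>

lemma twins_eigenvalue:
  fixes e :: "'i \<Rightarrow> 'f::field_char_0"
  assumes e: "\<And>i. i \<in> I \<Longrightarrow> e i \<noteq> 0"
    and d: "\<And>i v. i \<in> I \<Longrightarrow> v \<in> C i \<Longrightarrow> d v = e i"
    and i: "i \<in> I" "card (C i) > 1"
  shows "- of_bool (q i i) / e i \<in> pencil_spectrum (\<Union>i\<in>I. C i) (\<lambda>v w. of_bool (adj v w)) d"
proof -
  obtain u u' where u: "u \<in> C i" "u' \<in> C i" "u \<noteq> u'"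
    using i(2) card_le_Suc0_iff_eq[OF finite_cell[OF i(1)]] by (auto simp: not_le[symmetric])
  define x :: "'a \<Rightarrow> 'f" where "x v = of_bool (v = u) - of_bool (v = u')" for v
  have sum0: "(\<Sum>w\<in>C j. x w) = 0" if j: "j \<in> I" for j
  proof -
    have "u \<in> C j \<longleftrightarrow> u' \<in> C j" using u cell_unique i(1) j by blast
    then show ?thesis using finite_cell[OF j] by (auto simp: x_def sum_subtractf of_bool_def)
  qed
  have "(\<Sum>w\<in>(\<Union>j\<in>I. C j). of_bool (adj v w) * x w) = - of_bool (q i i) / e i * (d v * x v)"
    if j: "j \<in> I" and v: "v \<in> C j" for j v
  proof (cases "j = i")
    case True
    then show ?thesis
      unfolding adj_row_sum[OF j v] using sum0 d[OF j v] e[OF j] by simp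
  next
    case False
    then have "x v = 0" using u v i(1) j cell_unique by (auto simp: x_def)
    then show ?thesis unfolding adj_row_sum[OF j v] using sum0 by simp
  qed
  moreover have "\<exists>v\<in>(\<Union>i\<in>I. C i). x v \<noteq> 0" using u i(1) by (auto simp: x_def intro!: bexI[of _ i] bexI[of _ u])
  ultimately show ?thesis by (auto simp: pencil_spectrum_def intro!: exI[of _ x])
qed

text \<open>
  For the hard inclusion an eigenvector \<open>x\<close> is averaged over the cells. The averages form a
  quotient eigenvector unless they all vanish, and then \<open>x\<close> is a combination of the eigenvectors of
  the previous lemma.
\<close>

theorem pencil_spectrum_twins:
  fixes e :: "'i \<Rightarrow> 'f::field_char_0"
  assumes e: "\<And>i. i \<in> I \<Longrightarrow> e i \<noteq> 0"
    and d: "\<And>i v. i \<in> I \<Longrightarrow> v \<in> C i \<Longrightarrow> d v = e i"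
  shows "pencil_spectrum (\<Union>i\<in>I. C i) (\<lambda>v w. of_bool (adj v w)) d =
    pencil_spectrum I (\<lambda>i j. of_nat (neighbours i j)) e \<union>
    {- of_bool (q i i) / e i | i. i \<in> I \<and> card (C i) > 1}"
    (is "?A = ?B \<union> ?T")
proof
  show "?B \<union> ?T \<subseteq> ?A"
    using quotient_eigenvalue_lifts[where d = d and e = e] twins_eigenvalue[where d = d and e = e] e d
    by blast
next
  show "?A \<subseteq> ?B \<union> ?T"
  proof
    fix c assume "c \<in> ?A"
    then obtain x where nz: "\<exists>v\<in>(\<Union>i\<in>I. C i). x v \<noteq> 0"
      and x: "\<And>i v. \<lbrakk>i \<in> I; v \<in> C i\<rbrakk> \<Longrightarrow>
        (\<Sum>w\<in>(\<Union>j\<in>I. C j). of_bool (adj v w) * x w) = c * (d v * x v)"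
      unfolding pencil_spectrum_def by blast
    define Y where "Y j = (\<Sum>w\<in>C j. x w)" for j
    have row: "(\<Sum>j\<in>I. of_bool (q i j) * Y j) - of_bool (q i i) * x v = c * (e i * x v)"
      if "i \<in> I" "v \<in> C i" for i v
      using x[OF that] d[OF that] unfolding adj_row_sum[OF that] Y_def by simp
    show "c \<in> ?B \<union> ?T"
    proof (cases "\<exists>j\<in>I. Y j \<noteq> 0")
      case True
      define y where "y j = Y j / of_nat (card (C j))" for j
      have card_y: "of_nat (card (C j)) * y j = Y j" if "j \<in> I" for j
        using card_cell_pos[OF that] by (simp add: y_def)
      have "(\<Sum>j\<in>I. of_nat (neighbours i j) * y j) = c * (e i * y i)" if i: "i \<in> I" for i
      proof -
        let ?m = "of_nat (card (C i)) :: 'f" and ?S = "\<Sum>j\<in>I. of_bool (q i j) * Y j"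
        have m: "?m \<noteq> 0" using card_cell_pos[OF i] by simp
        \<comment> \<open>The equations at the vertices of \<open>C i\<close> are added up.\<close>
        have "(\<Sum>v\<in>C i. ?S - of_bool (q i i) * x v) = (\<Sum>v\<in>C i. c * (e i * x v))"
          using row[OF i] by (rule sum.cong[OF refl])
        then have "?m * ?S - of_bool (q i i) * Y i = c * (e i * Y i)"
          by (simp add: sum_subtractf sum_distrib_left[symmetric] Y_def)
        then have "?m * (?S - of_bool (q i i) * y i) = ?m * (c * (e i * y i))"
          by (simp add: card_y[OF i, symmetric] algebra_simps)
        then have "?S - of_bool (q i i) * y i = c * (e i * y i)" using m by simp
        then show ?thesis unfolding neighbours_row_sum[OF i] by (simp add: card_y)
      qed
      moreover have "\<exists>j\<in>I. y j \<noteq> 0" using True card_y by force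
      ultimately show ?thesis by (auto simp: pencil_spectrum_def)
    next
      case False
      then have Y: "Y j = 0" if "j \<in> I" for j using that by blast
      from nz obtain i v where i: "i \<in> I" and v: "v \<in> C i" "x v \<noteq> 0" by blast
      have "- of_bool (q i i) * x v = (c * e i) * x v"
        using row[OF i v(1)] Y by (simp add: mult.assoc)
      then have "- of_bool (q i i) = c * e i" using mult_right_cancel[OF v(2)] by blast
      then have "c = - of_bool (q i i) / e i"
        using nonzero_eq_divide_eq[OF e[OF i]] by metis
      moreover have "card (C i) \<noteq> 1"
      proof
        assume "card (C i) = 1"
        then have "C i = {v}" using v(1) by (auto simp: card_1_singleton_iff)
        then show False using Y[OF i] v(2) by (simp add: Y_def)
      qed
      ultimately show ?thesis using i card_cell_pos[OF i] by (force simp: less_Suc_eq)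
    qed
  qed
qed

end

section \<open>The cells of a threshold graph\<close>

lemma twin_partition_cell:
  assumes "\<And>i. i \<in> {1..k} \<Longrightarrow> s i > 0" and "\<And>i. i \<in> {1..k} \<Longrightarrow> t i > 0"
  shows "twin_partition {1..2 * k} (cell s t)
    (\<lambda>v w. v \<rightarrow>\<^bsub>with_proj (threshold_graph (block_string k s t))\<^esub> w) (\<lambda>i j. even (max i j))"
proof
  show "cell s t i \<noteq> {}" if "i \<in> {1..2 * k}" for i
  proof -
    have "cell_size s t i > 0"
      using that assms by (auto simp: cell_size_def elim!: oddE evenE)
    then show ?thesis using card_cell[of i s t] that by fastforce
  qed
  show "disjoint_family_on (cell s t) {1..2 * k}"
    using cell_less by (fastforce simp: disjoint_family_on_def neq_iff)
  show "v \<rightarrow>\<^bsub>with_proj (threshold_graph (block_string k s t))\<^esub> w \<longleftrightarrow> v \<noteq> w \<and> even (max i j)"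
    if ij: "i \<in> {1..2 * k}" "j \<in> {1..2 * k}" and vw: "v \<in> cell s t i" "w \<in> cell s t j" for i j v w
  proof -
    have "v \<in> {1..length (block_string k s t)}" "w \<in> {1..length (block_string k s t)}"
      using ij vw cell_subset[of i "2 * k" s t] cell_subset[of j "2 * k" s t]
      unfolding length_block_string by auto
    moreover have "max v w \<in> cell s t (max i j)"
      using vw cell_less[of i j v s t w] cell_less[of j i w s t v]
      by (cases i j rule: linorder_cases) (auto simp: max_def)
    then have "block_string k s t ! (max v w - 1) \<longleftrightarrow> even (max i j)"
      using ij by (intro block_string_nth) (auto simp: max_def)
    ultimately show ?thesis by (auto simp: threshold_graph_arcs)
  qed
qed (auto simp: cell_def)

lemma sum_pairs_up_to:
  fixes f :: "nat \<Rightarrow> 'b::comm_monoid_add"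
  shows "(\<Sum>j = 1..2 * k. f j) = (\<Sum>l = 1..k. f (2 * l - 1)) + (\<Sum>l = 1..k. f (2 * l))"
  by (induction k) (simp_all add: ac_simps)

lemma out_degree_with_proj:
  assumes "pair_wf_digraph G"
  shows "out_degree (with_proj G) v = card {w \<in> pverts G. v \<rightarrow>\<^bsub>with_proj G\<^esub> w}"
proof -
  interpret pair_wf_digraph G by fact
  have "out_arcs (with_proj G) v = Pair v ` {w \<in> pverts G. v \<rightarrow>\<^bsub>with_proj G\<^esub> w}"
    using in_arcsD2 by (auto simp: out_arcs_def)
  then show ?thesis by (simp add: out_degree_def card_image inj_on_def)
qed

context
  fixes k :: nat and s t :: "nat \<Rightarrow> nat"
  assumes k: "k \<ge> 1"
    and s: "\<And>i. i \<in> {1..k} \<Longrightarrow> s i > 0"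
    and t: "\<And>i. i \<in> {1..k} \<Longrightarrow> t i > 0"
begin

abbreviation (input) block_graph :: "nat pair_pre_digraph" where
  "block_graph \<equiv> threshold_graph (block_string k s t)"

interpretation twin_partition "{1..2 * k}" "cell s t" "\<lambda>v w. v \<rightarrow>\<^bsub>with_proj block_graph\<^esub> w"
  "\<lambda>i j. even (max i j)"
  using s t by (rule twin_partition_cell)

definition degree_of_cell :: "nat \<Rightarrow> nat" where
  "degree_of_cell i = (\<Sum>j = 1..2 * k. neighbours i j)"

lemma neighbours_cell:
  assumes "i \<in> {1..2 * k}" "j \<in> {1..2 * k}"
  shows "cell_degree block_graph (cell s t) i j = neighbours i j"
proof -
  obtain v where "v \<in> cell s t i" using cell_nonempty assms(1) by blast
  then show ?thesis
    unfolding cell_degree_eq[OF assms \<open>v \<in> cell s t i\<close>] card_neighbours_cell[OF assms \<open>v \<in> cell s t i\<close>]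
    using assms by (simp add: neighbours_def card_cell)
qed

lemma verts_UN_cell: "(\<Union>i\<in>{1..2 * k}. cell s t i) = pverts block_graph"
  by (simp only: UN_cell threshold_graph_verts length_block_string)

lemma out_degree_cell:
  assumes "i \<in> {1..2 * k}" "v \<in> cell s t i"
  shows "out_degree (with_proj block_graph) v = degree_of_cell i"
proof -
  interpret pair_graph block_graph by (rule pair_graph_threshold_graph)
  show ?thesis
    using card_adj[OF assms]
    unfolding out_degree_with_proj[OF pair_wf_digraph_axioms] verts_UN_cell degree_of_cell_def .
qed

text \<open>The last cell dominates all others, and its own vertices see the first cell.\<close>

lemma degree_of_cell_pos:
  assumes "i \<in> {1..2 * k}"
  shows "degree_of_cell i > 0"
proof -
  have "\<exists>j\<in>{1..2 * k}. neighbours i j > 0"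
  proof (cases "i = 2 * k")
    case True
    then show ?thesis
      using k card_cell_pos[of 1] by (intro bexI[of _ 1]) (auto simp: neighbours_def max.absorb1)
  next
    case False
    then show ?thesis
      using k assms card_cell_pos[of "2 * k"]
      by (intro bexI[of _ "2 * k"]) (auto simp: neighbours_def max.absorb2)
  qed
  then show ?thesis by (auto simp: degree_of_cell_def intro!: sum_pos2)
qed

lemma degree_of_even_cell:
  assumes m: "m \<in> {1..k}"
  shows "(of_nat (degree_of_cell (2 * m)) :: complex) =
    of_nat (\<Sum>l = 1..k. t l) + of_nat (\<Sum>l = 1..m. s l) - 1"
proof -
  let ?f = "\<lambda>j. of_bool (even (max (2 * m) j)) * of_nat (cell_size s t j) :: complex"
  have "of_nat (degree_of_cell (2 * m)) = (\<Sum>j = 1..2 * k. ?f j) - 1"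
    using neighbours_row_sum[of "2 * m" "\<lambda>_. 1 :: complex"] m
    by (simp add: degree_of_cell_def card_cell)
  also have "(\<Sum>j = 1..2 * k. ?f j) = (\<Sum>l = 1..k. ?f (2 * l - 1)) + (\<Sum>l = 1..k. ?f (2 * l))"
    by (rule sum_pairs_up_to)
  also have "(\<Sum>l = 1..k. ?f (2 * l)) = of_nat (\<Sum>l = 1..k. t l)"
    by (simp add: cell_size_def max_def)
  also have "(\<Sum>l = 1..k. ?f (2 * l - 1)) = (\<Sum>l = 1..k. if l \<le> m then of_nat (s l) else 0)"
    by (intro sum.cong) (auto simp: cell_size_def max_def)
  also have "\<dots> = (\<Sum>l = 1..m. of_nat (s l))"
    using m by (intro sum.mono_neutral_cong_right) auto
  finally show ?thesis by simp
qed

lemma sum_gt_number_iff: "(\<Sum>i = 1..k. s i) > k \<longleftrightarrow> (\<exists>i\<in>{1..k}. s i > 1)"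
proof
  assume "\<exists>i\<in>{1..k}. s i > 1"
  then have "(\<Sum>i = 1..k. 1) < (\<Sum>i = 1..k. s i)"
    using s by (intro sum_strict_mono_ex1) (auto simp: Suc_le_eq)
  then show "(\<Sum>i = 1..k. s i) > k" by simp
next
  assume gt: "(\<Sum>i = 1..k. s i) > k"
  show "\<exists>i\<in>{1..k}. s i > 1"
  proof (rule ccontr)
    assume "\<not> ?thesis"
    then have "(\<Sum>i = 1..k. s i) \<le> (\<Sum>i = 1..k. 1)" by (intro sum_mono) (auto simp: not_less)
    with gt show False by simp
  qed
qed

text \<open>
  Odd cells contribute \<open>0\<close>, and only if one of them has two vertices; the cell \<open>2 m\<close> contributes
  \<open>-1 / (t + S\<^sub>m - 1)\<close>.
\<close>

lemma T_set_eq: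
  "T_set k s t = {- of_bool (even (max i i)) / of_nat (degree_of_cell i) | i.
     i \<in> {1..2 * k} \<and> card (cell s t i) > 1}" (is "_ = ?T")
proof -
  define R where "R = {- 1 / (of_nat (\<Sum>i = 1..k. t i) + of_nat (\<Sum>j = 1..i. s j) - 1 :: complex) | i.
      i \<in> {1..k} \<and> t i > 1}"
  have eq: "{1..2 * k} = (\<lambda>l. 2 * l - 1) ` {1..k} \<union> (\<lambda>l. 2 * l) ` {1..k}"
  proof (intro equalityI subsetI)
    fix i assume "i \<in> {1..2 * k}"
    then show "i \<in> (\<lambda>l. 2 * l - 1) ` {1..k} \<union> (\<lambda>l. 2 * l) ` {1..k}"
    proof (cases "even i")
      case True
      with \<open>i \<in> {1..2 * k}\<close> show ?thesis by (auto elim!: evenE)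
    next
      case False
      with \<open>i \<in> {1..2 * k}\<close> show ?thesis by (auto elim!: oddE intro!: image_eqI[of _ _ "Suc _"])
    qed
  qed auto
  let ?g = "\<lambda>i. - of_bool (even (max i i)) / of_nat (degree_of_cell i) :: complex"
  have "?T = ?g ` {i \<in> {1..2 * k}. card (cell s t i) > 1}" by auto
  also have "{i \<in> {1..2 * k}. card (cell s t i) > 1} =
      (\<lambda>l. 2 * l - 1) ` {l \<in> {1..k}. s l > 1} \<union> (\<lambda>l. 2 * l) ` {l \<in> {1..k}. t l > 1}"
    unfolding eq by (auto simp: card_cell cell_size_def)
  also have "?g ` \<dots> = (\<lambda>l. 0) ` {l \<in> {1..k}. s l > 1} \<union>
      (\<lambda>m. - 1 / of_nat (degree_of_cell (2 * m))) ` {l \<in> {1..k}. t l > 1}"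
    unfolding image_Un image_image by (intro arg_cong2[of _ _ _ _ "(\<union>)"] image_cong) auto
  also have "(\<lambda>m. - 1 / of_nat (degree_of_cell (2 * m)) :: complex) ` {l \<in> {1..k}. t l > 1} = R"
    using degree_of_even_cell by (auto simp: R_def simp del: of_nat_sum)
  also have "(\<lambda>l. 0) ` {l \<in> {1..k}. s l > 1} = (if (\<Sum>i = 1..k. s i) > k then {0} else {})"
    using sum_gt_number_iff by auto
  finally show ?thesis by (auto simp: T_set_def Let_def R_def)
qed

lemma spectrum_normalized_adjacency_matrix:
  "spectrum (normalized_adjacency_matrix block_graph) =
   pencil_spectrum (\<Union>i\<in>{1..2 * k}. cell s t i) (\<lambda>v w. of_bool (v \<rightarrow>\<^bsub>with_proj block_graph\<^esub> w))
     (\<lambda>v. of_nat (out_degree (with_proj block_graph) v))"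
proof -
  let ?n = "length (block_string k s t)"
  have V: "pverts block_graph = {1..?n}" by (rule threshold_graph_verts)
  have "out_degree (with_proj block_graph) v \<noteq> 0" if v: "v \<in> {1..?n}" for v
  proof -
    obtain i where i: "i \<in> {1..2 * k}" "v \<in> cell s t i"
      using v unfolding V[symmetric] verts_UN_cell[symmetric] by blast
    then show ?thesis using out_degree_cell degree_of_cell_pos by simp
  qed
  then show ?thesis
    unfolding normalized_adjacency_matrix_def degree_matrix_def adjacency_matrix_def verts_UN_cell V
    by (subst spectrum_inverse_diag_times[symmetric]) simp_all
qed

lemma spectrum_normalized_quotient_matrix:
  "spectrum (normalized_quotient_matrix block_graph (cell s t) (2 * k)) =
   pencil_spectrum {1..2 * k} (\<lambda>i j. of_nat (neighbours i j)) (\<lambda>i. of_nat (degree_of_cell i))"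
proof -
  have deg: "(\<Sum>j = 1..2 * k. cell_degree block_graph (cell s t) i j) = degree_of_cell i"
    if "i \<in> {1..2 * k}" for i
    unfolding degree_of_cell_def using that by (intro sum.cong refl neighbours_cell)
  have "spectrum (normalized_quotient_matrix block_graph (cell s t) (2 * k)) =
      pencil_spectrum {1..2 * k} (\<lambda>i j. of_nat (cell_degree block_graph (cell s t) i j))
        (\<lambda>i. of_nat (\<Sum>j = 1..2 * k. cell_degree block_graph (cell s t) i j))"
    unfolding normalized_quotient_matrix_def quotient_degree_matrix_def quotient_matrix_def
    by (rule spectrum_inverse_diag_times) (use deg degree_of_cell_pos in \<open>fastforce simp del: of_nat_sum\<close>)
  also have "\<dots> = pencil_spectrum {1..2 * k} (\<lambda>i j. of_nat (neighbours i j))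
      (\<lambda>i. of_nat (degree_of_cell i))"
    by (rule pencil_spectrum_cong) (simp_all only: neighbours_cell deg)
  finally show ?thesis .
qed

lemma spectrum_threshold_graph:
  "spectrum (normalized_adjacency_matrix block_graph) =
   spectrum (normalized_quotient_matrix block_graph (cell s t) (2 * k)) \<union> T_set k s t"
  unfolding spectrum_normalized_adjacency_matrix spectrum_normalized_quotient_matrix T_set_eq
proof (rule pencil_spectrum_twins)
  show "(of_nat (degree_of_cell i) :: complex) \<noteq> 0" if "i \<in> {1..2 * k}" for i
    using degree_of_cell_pos[OF that] by simp
  show "(of_nat (out_degree (with_proj block_graph) v) :: complex) = of_nat (degree_of_cell i)"
    if "i \<in> {1..2 * k}" "v \<in> cell s t i" for i v
    by (simp only: out_degree_cell[OF that])
qed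

end

theorem theorem2p4:
  fixes k :: nat and s t :: "nat \<Rightarrow> nat" and \<Gamma> :: "nat pair_pre_digraph"
  assumes "k \<ge> 1"
    and "\<And>i. i \<in> {1..k} \<Longrightarrow> s i > 0"
    and "\<And>i. i \<in> {1..k} \<Longrightarrow> t i > 0"
    and "\<Gamma> = threshold_graph (block_string k s t)"
  shows "spectrum (normalized_adjacency_matrix \<Gamma>) =
         spectrum (normalized_quotient_matrix \<Gamma> (cell s t) (2 * k)) \<union> T_set k s t"
  unfolding assms(4) using assms(1-3) by (rule spectrum_threshold_graph)

end
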